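(* Let $S$, $S'$, $S''$ be square matrices over $\mathbb{Q}$. Suppose that $S$ is S-equivalent (over $\mathbb{Q}$) to $S'$ and to $S''$, where $S'=S'_0\oplus S'_{in}$ and $S''=S''_0\oplus S''_{in}$ are block sums such that $S'_0$ and $S''_0$ are (square) zero matrices and $S'_{in}$ and $S''_{in}$ are invertible over $\mathbb{Q}$. Then $S'_{in}$ and $S''_{in}$ are congruent over $\mathbb{Q}$.
   Context: All matrices have entries in $\mathbb{Q}$. Two square matrices $A,B$ of the same size are congruent if $B=P^TAP$ for some invertible rational matrix $P$. S-equivalence over $\mathbb{Q}$ is the equivalence relation on square rational matrices generated by congruence over $\mathbb{Q}$ and by the elementary enlargements $$A\sim\begin{pmatrix}A&\alpha&0\\0&0&1\\0&0&0\end{pmatrix},\qquad A\sim\begin{pmatrix}A&0&0\\\alpha^T&0&0\\0&1&0\end{pmatrix},$$ where $\alpha$ is any rational column vector. Zero blocks, or invertible blocks, of size $0$ are allowed in a block sum. *)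

theory Defs
  imports "Jordan_Normal_Form.Matrix"
begin

definition congruent_mat :: "rat mat \<Rightarrow> rat mat \<Rightarrow> bool" where
  "congruent_mat A B \<longleftrightarrow>
     (\<exists>n P. A \<in> carrier_mat n n \<and> B \<in> carrier_mat n n \<and> P \<in> carrier_mat n n \<and>
        invertible_mat P \<and> B = transpose_mat P * A * P)"

text \<open>
  For a square matrix \<open>A\<close> of size \<open>n\<close> and a vector \<open>\<alpha>\<close> of dimension \<open>n\<close>, the two enlargements
  are the matrices with rows of blocks \<open>(A, \<alpha>, 0), (0, 0, 1), (0, 0, 0)\<close> and
  \<open>(A, 0, 0), (\<alpha>\<^sup>T, 0, 0), (0, 1, 0)\<close>; the last two rows and the last two columns are each
  grouped into one block.
\<close>

definition col_enlargement :: "rat mat \<Rightarrow> rat vec \<Rightarrow> rat mat" where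
  "col_enlargement A \<alpha> = (let n = dim_row A in
     four_block_mat A          (mat_of_cols n [\<alpha>, 0\<^sub>v n])
                    (0\<^sub>m 2 n)  (mat_of_rows_list 2 [[0, 1], [0, 0]]))"

definition row_enlargement :: "rat mat \<Rightarrow> rat vec \<Rightarrow> rat mat" where
  "row_enlargement A \<alpha> = (let n = dim_row A in
     four_block_mat A                           (0\<^sub>m n 2)
                    (mat_of_rows n [\<alpha>, 0\<^sub>v n])  (mat_of_rows_list 2 [[0, 0], [1, 0]]))"

inductive S_move :: "rat mat \<Rightarrow> rat mat \<Rightarrow> bool" where
  congruence: "congruent_mat A B \<Longrightarrow> S_move A B"
| col_enlarge: "A \<in> carrier_mat n n \<Longrightarrow> \<alpha> \<in> carrier_vec n \<Longrightarrow> S_move A (col_enlargement A \<alpha>)"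
| row_enlarge: "A \<in> carrier_mat n n \<Longrightarrow> \<alpha> \<in> carrier_vec n \<Longrightarrow> S_move A (row_enlargement A \<alpha>)"

text \<open>
  The type \<open>rat mat\<close> also contains non-square matrices. No move applies to them, so
  the equivalence closure relates each of them only to itself, and on square matrices it is
  the intended relation.
\<close>

definition S_equivalent :: "rat mat \<Rightarrow> rat mat \<Rightarrow> bool" where
  "S_equivalent = equivclp S_move"

end

theory Submission
  imports Defs "Jordan_Normal_Form.Determinant"
begin

text \<open>
  Read a square matrix as a bilinear form \<open>b\<close> on a space of column vectors. If \<open>y\<close> lies in the left
  radical, that is, \<open>b y v = 0\<close> for all \<open>v\<close>, then the orthogonal \<open>{v. b v y = 0}\<close> contains \<open>y\<close>, and
  \<open>b\<close> induces a form on the quotient of this orthogonal by \<open>y\<close>. The same can be done with vectors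
  of the right radical. Such a reduction undoes an elementary enlargement: for a column
  enlargement take \<open>y\<close> to be the last basis vector; the quotient is the form of the matrix
  that was enlarged (\<open>enlargement_cut\<close>).

  It therefore suffices that the nondegenerate form reached by reductions, the core, does not
  depend on the reductions chosen (\<open>has_core_cut_iff\<close>). This is a diamond property
  (\<open>cuts_confluent\<close>). Two reductions on the same side commute, and so do a left reduction by \<open>y\<close>
  and a right reduction by \<open>z\<close> when \<open>b z y = 0\<close>. If \<open>b z y \<noteq> 0\<close>, they do not commute, but both
  quotients are isometric to the intersection of the two orthogonals.

  The core is thus an invariant of S-equivalence. A matrix that is the sum of a zero block and an
  invertible block has the invertible block as core, and an invertible matrix is its own core.
  Hence the two invertible blocks carry isometric forms, which is congruence of matrices.

  Quotients are avoided by a single device. A reduction only restricts the form to the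
  orthogonal, and the form-preserving surjections between sets with a form take care of what
  the quotient would remove. Such a surjection transports reductions in both directions
  (\<open>has_core_pull\<close>, \<open>has_core_push\<close>), and between nondegenerate forms it is a bijection.
\<close>

section \<open>Cutting a form by vectors of its one-sided radicals\<close>

text \<open>
  For a subspace \<open>U\<close> and \<open>y \<in> U\<close> with \<open>b y v = 0\<close> throughout \<open>U\<close>, the cut is the orthogonal
  \<open>{v. b v y = 0}\<close> of \<open>y\<close> on the other side. Since \<open>b y y = 0\<close>, it contains \<open>y\<close>, and there \<open>y\<close>
  lies in both radicals. The classical reduction would go on to the quotient by \<open>y\<close>;
  leaving \<open>y\<close> in place keeps all reductions of a form among the subsets of one fixed space.
\<close>
definition left_cut :: "('a \<Rightarrow> 'a \<Rightarrow> 'k::field) \<Rightarrow> 'a set \<Rightarrow> 'a set \<Rightarrow> bool" where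
  "left_cut b U U' \<longleftrightarrow> (\<exists>y\<in>U. (\<forall>v\<in>U. b y v = 0) \<and> U' = {v\<in>U. b v y = 0})"

definition radical_cut :: "('a \<Rightarrow> 'a \<Rightarrow> 'k::field) \<Rightarrow> 'a set \<Rightarrow> 'a set \<Rightarrow> bool" where
  "radical_cut b U U' \<longleftrightarrow> left_cut b U U' \<or> left_cut (\<lambda>u v. b v u) U U'"

text \<open>
  This covers at once the isometries and the quotients by vectors of the two-sided radical:
  two vectors with the same image have the same products with all of \<open>U\<close>.
\<close>
definition form_onto :: "('a \<Rightarrow> 'a \<Rightarrow> 'k) \<Rightarrow> 'a set \<Rightarrow> ('b \<Rightarrow> 'b \<Rightarrow> 'k) \<Rightarrow> 'b set \<Rightarrow> bool" where
  "form_onto b U c W \<longleftrightarrow> (\<exists>h. h ` U = W \<and> (\<forall>u\<in>U. \<forall>v\<in>U. b u v = c (h u) (h v)))"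

definition has_core ::
  "('a \<Rightarrow> 'a \<Rightarrow> 'k::field) \<Rightarrow> 'a set \<Rightarrow> ('b \<Rightarrow> 'b \<Rightarrow> 'k) \<Rightarrow> 'b set \<Rightarrow> bool" where
  "has_core b U c W \<longleftrightarrow> (\<exists>U'. (radical_cut b)\<^sup>*\<^sup>* U U' \<and> form_onto b U' c W)"

definition nondegenerate :: "('a \<Rightarrow> 'a \<Rightarrow> 'k) \<Rightarrow> 'a set \<Rightarrow> bool" where
  "nondegenerate b U \<longleftrightarrow> (\<forall>x\<in>U. \<forall>y\<in>U.
     ((\<forall>t\<in>U. b x t = b y t) \<longrightarrow> x = y) \<and> ((\<forall>t\<in>U. b t x = b t y) \<longrightarrow> x = y))"

text \<open>
  All that is used of linear structure: for \<open>u\<close>, \<open>v\<close> and a scalar \<open>k\<close>, some element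
  behaves under the form like \<open>u + k * v\<close>. Unlike closure under addition, this can be said
  for a set without operations.
\<close>
definition has_combinations :: "('a \<Rightarrow> 'a \<Rightarrow> 'k::field) \<Rightarrow> 'a set \<Rightarrow> bool" where
  "has_combinations b U \<longleftrightarrow> (\<forall>u\<in>U. \<forall>v\<in>U. \<forall>k. \<exists>w\<in>U. \<forall>t\<in>U.
     b w t = b u t + k * b v t \<and> b t w = b t u + k * b t v)"

lemma form_onto_refl: "form_onto b U b U"
  unfolding form_onto_def by (rule exI[of _ id]) auto

lemma form_onto_flip: "form_onto (\<lambda>u v. b v u) U (\<lambda>u v. c v u) W \<longleftrightarrow> form_onto b U c W"
proof -
  have "(\<forall>u\<in>U. \<forall>v\<in>U. b v u = c (h v) (h u)) \<longleftrightarrow> (\<forall>u\<in>U. \<forall>v\<in>U. b u v = c (h u) (h v))" for h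
    by auto
  thus ?thesis unfolding form_onto_def by simp
qed

lemma form_onto_trans:
  assumes "form_onto b U c W" "form_onto c W d N"
  shows "form_onto b U d N"
proof -
  obtain g where g: "g ` U = W" "\<forall>u\<in>U. \<forall>v\<in>U. b u v = c (g u) (g v)"
    using assms(1) unfolding form_onto_def by blast
  obtain h where h: "h ` W = N" "\<forall>u\<in>W. \<forall>v\<in>W. c u v = d (h u) (h v)"
    using assms(2) unfolding form_onto_def by blast
  have "(h \<circ> g) ` U = N" using g(1) h(1) by auto
  moreover have "\<forall>u\<in>U. \<forall>v\<in>U. b u v = d ((h \<circ> g) u) ((h \<circ> g) v)" using g h by auto
  ultimately show ?thesis unfolding form_onto_def by blast
qed

text \<open>
  A form-preserving surjection matches the vectors in the left radicals of its two sides, and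
  the corresponding cuts. Thus cuts can be carried along it in both directions.
\<close>
lemma left_cut_pull:
  assumes "form_onto b U c W" "left_cut c W W1"
  shows "\<exists>U1. left_cut b U U1 \<and> form_onto b U1 c W1"
proof -
  obtain h where h: "h ` U = W" and hb: "\<And>u v. u\<in>U \<Longrightarrow> v\<in>U \<Longrightarrow> b u v = c (h u) (h v)"
    using assms(1) unfolding form_onto_def by blast
  obtain y where y: "y \<in> W" "\<forall>v\<in>W. c y v = 0" "W1 = {v\<in>W. c v y = 0}"
    using assms(2) unfolding left_cut_def by blast
  obtain x where x: "x \<in> U" "h x = y" using y(1) h by blast
  let ?U1 = "{v\<in>U. b v x = 0}"
  have "left_cut b U ?U1" unfolding left_cut_def
    using x y(2) h hb by (intro bexI[of _ x]) auto
  moreover have "h ` ?U1 = W1" unfolding y(3) using h hb x by auto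
  hence "form_onto b ?U1 c W1" unfolding form_onto_def using hb by (intro exI[of _ h]) auto
  ultimately show ?thesis by blast
qed

lemma left_cut_push:
  assumes "form_onto b U c W" "left_cut b U U1"
  shows "\<exists>W1. left_cut c W W1 \<and> form_onto b U1 c W1"
proof -
  obtain h where h: "h ` U = W" and hb: "\<And>u v. u\<in>U \<Longrightarrow> v\<in>U \<Longrightarrow> b u v = c (h u) (h v)"
    using assms(1) unfolding form_onto_def by blast
  obtain y where y: "y \<in> U" "\<forall>v\<in>U. b y v = 0" "U1 = {v\<in>U. b v y = 0}"
    using assms(2) unfolding left_cut_def by blast
  let ?W1 = "{v\<in>W. c v (h y) = 0}"
  have "left_cut c W ?W1" unfolding left_cut_def
    using y h hb by (intro bexI[of _ "h y"]) auto
  moreover have "h ` U1 = ?W1" unfolding y(3) using h hb y by auto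
  hence "form_onto b U1 c ?W1" unfolding form_onto_def using hb y(3) by (intro exI[of _ h]) auto
  ultimately show ?thesis by blast
qed

lemma cut_pull:
  assumes "form_onto b U c W" "radical_cut c W W1"
  shows "\<exists>U1. radical_cut b U U1 \<and> form_onto b U1 c W1"
  using assms(2) unfolding radical_cut_def
proof
  assume "left_cut c W W1"
  from left_cut_pull[OF assms(1) this]
  show "\<exists>U1. (left_cut b U U1 \<or> left_cut (\<lambda>u v. b v u) U U1) \<and> form_onto b U1 c W1" by blast
next
  assume "left_cut (\<lambda>u v. c v u) W W1"
  from left_cut_pull[OF form_onto_flip[THEN iffD2, OF assms(1)] this]
  obtain U1 where "left_cut (\<lambda>u v. b v u) U U1" "form_onto (\<lambda>u v. b v u) U1 (\<lambda>u v. c v u) W1"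
    by blast
  moreover from this(2) have "form_onto b U1 c W1" by (rule form_onto_flip[THEN iffD1])
  ultimately show "\<exists>U1. (left_cut b U U1 \<or> left_cut (\<lambda>u v. b v u) U U1) \<and> form_onto b U1 c W1"
    by blast
qed

lemma cut_push:
  assumes "form_onto b U c W" "radical_cut b U U1"
  shows "\<exists>W1. radical_cut c W W1 \<and> form_onto b U1 c W1"
  using assms(2) unfolding radical_cut_def
proof
  assume "left_cut b U U1"
  from left_cut_push[OF assms(1) this]
  show "\<exists>W1. (left_cut c W W1 \<or> left_cut (\<lambda>u v. c v u) W W1) \<and> form_onto b U1 c W1" by blast
next
  assume "left_cut (\<lambda>u v. b v u) U U1"
  from left_cut_push[OF form_onto_flip[THEN iffD2, OF assms(1)] this]
  obtain W1 where "left_cut (\<lambda>u v. c v u) W W1" "form_onto (\<lambda>u v. b v u) U1 (\<lambda>u v. c v u) W1"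
    by blast
  moreover from this(2) have "form_onto b U1 c W1" by (rule form_onto_flip[THEN iffD1])
  ultimately show "\<exists>W1. (left_cut c W W1 \<or> left_cut (\<lambda>u v. c v u) W W1) \<and> form_onto b U1 c W1"
    by blast
qed

text \<open>
  Nondegeneracy is what makes the factoring possible: vectors that the first map identifies
  have the same products with everything, hence the second map identifies them too.
\<close>
lemma form_onto_factor:
  assumes "form_onto b U c W" "form_onto b U d N" "nondegenerate d N"
  shows "form_onto c W d N"
proof -
  obtain g where g: "g ` U = W" and gb: "\<And>u v. u\<in>U \<Longrightarrow> v\<in>U \<Longrightarrow> b u v = c (g u) (g v)"
    using assms(1) unfolding form_onto_def by blast
  obtain h where h: "h ` U = N" and hb: "\<And>u v. u\<in>U \<Longrightarrow> v\<in>U \<Longrightarrow> b u v = d (h u) (h v)"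
    using assms(2) unfolding form_onto_def by blast
  have eq: "h u = h v" if "u\<in>U" "v\<in>U" "g u = g v" for u v
  proof -
    have "d (h u) (h t) = d (h v) (h t)" if "t\<in>U" for t
      using gb[of u t] gb[of v t] hb[of u t] hb[of v t] that \<open>u\<in>U\<close> \<open>v\<in>U\<close> \<open>g u = g v\<close> by simp
    hence "\<forall>t\<in>N. d (h u) t = d (h v) t" using h by auto
    thus ?thesis using assms(3) h that unfolding nondegenerate_def by blast
  qed
  define k where "k w = h (inv_into U g w)" for w
  have k: "k (g u) = h u" if "u\<in>U" for u
    unfolding k_def using that by (intro eq) (auto simp: inv_into_into f_inv_into_f)
  have "k ` W = N" unfolding g[symmetric] h[symmetric] image_image using k by auto
  moreover have "\<forall>u\<in>W. \<forall>v\<in>W. c u v = d (k u) (k v)"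
    unfolding g[symmetric] using k gb hb by auto
  ultimately show ?thesis unfolding form_onto_def by blast
qed

section \<open>Cores and form-preserving surjections\<close>

lemma has_core_cut: "radical_cut b U U1 \<Longrightarrow> has_core b U1 d N \<Longrightarrow> has_core b U d N"
  unfolding has_core_def by (meson converse_rtranclp_into_rtranclp)

lemma has_core_pull:
  assumes "form_onto b U c W" "has_core c W d N"
  shows "has_core b U d N"
proof -
  obtain W' where "(radical_cut c)\<^sup>*\<^sup>* W W'" "form_onto c W' d N"
    using assms(2) unfolding has_core_def by blast
  thus ?thesis using assms(1)
  proof (induction arbitrary: U rule: converse_rtranclp_induct)
    case base
    thus ?case unfolding has_core_def using form_onto_trans by blast
  next
    case (step W W1)
    thus ?case using cut_pull has_core_cut by metis
  qed
qed

lemma has_core_push: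
  assumes "form_onto b U c W" "has_core b U d N" "nondegenerate d N"
  shows "has_core c W d N"
proof -
  obtain U' where "(radical_cut b)\<^sup>*\<^sup>* U U'" "form_onto b U' d N"
    using assms(2) unfolding has_core_def by blast
  thus ?thesis using assms(1)
  proof (induction arbitrary: W rule: converse_rtranclp_induct)
    case base
    thus ?case unfolding has_core_def using form_onto_factor assms(3) by blast
  next
    case (step U U1)
    thus ?case using cut_push has_core_cut by metis
  qed
qed

section \<open>Confluence of cuts\<close>

lemma has_combinations_left_cut:
  assumes "has_combinations b U" "left_cut b U U1"
  shows "has_combinations b U1"
proof -
  obtain y where y: "y \<in> U" "\<forall>v\<in>U. b y v = 0" "U1 = {v\<in>U. b v y = 0}"
    using assms(2) unfolding left_cut_def by blast
  show ?thesis unfolding has_combinations_def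
  proof (intro ballI allI)
    fix u v k assume uv: "u \<in> U1" "v \<in> U1"
    then obtain w where w: "w\<in>U" "\<forall>t\<in>U. b w t = b u t + k * b v t \<and> b t w = b t u + k * b t v"
      using assms(1) y(3) unfolding has_combinations_def by blast
    have "w \<in> U1" using w uv y by auto
    thus "\<exists>w\<in>U1. \<forall>t\<in>U1. b w t = b u t + k * b v t \<and> b t w = b t u + k * b t v"
      using w(2) y(3) by auto
  qed
qed

lemma has_combinations_flip: "has_combinations (\<lambda>u v. b v u) U \<longleftrightarrow> has_combinations b U"
  unfolding has_combinations_def by (intro ball_cong bex_cong all_cong1 refl conj_commute)

lemma has_combinations_cut:
  assumes "has_combinations b U" "radical_cut b U U1"
  shows "has_combinations b U1"
  using assms(2) unfolding radical_cut_def
proof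
  assume "left_cut b U U1"
  thus ?thesis by (rule has_combinations_left_cut[OF assms(1)])
next
  assume "left_cut (\<lambda>u v. b v u) U U1"
  thus ?thesis
    by (rule has_combinations_flip[THEN iffD1,
          OF has_combinations_left_cut[OF has_combinations_flip[THEN iffD2, OF assms(1)]]])
qed

text \<open>
  A left radical vector \<open>y\<close> has the same left products as a zero vector, so a map onto a
  nondegenerate form cannot tell them apart; hence the products with \<open>y\<close> on the right vanish too.
\<close>
lemma left_cut_trivial:
  assumes "has_combinations b U" "form_onto b U d N" "nondegenerate d N" "left_cut b U U1"
  shows "U1 = U"
proof -
  obtain h where h: "h ` U = N" and hb: "\<And>u v. u\<in>U \<Longrightarrow> v\<in>U \<Longrightarrow> b u v = d (h u) (h v)"
    using assms(2) unfolding form_onto_def by blast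
  obtain y where y: "y \<in> U" "\<forall>v\<in>U. b y v = 0" "U1 = {v\<in>U. b v y = 0}"
    using assms(4) unfolding left_cut_def by blast
  \<comment> \<open>\<open>z\<close> plays the part of the zero vector \<open>y - y\<close>.\<close>
  obtain z where z: "z\<in>U" "\<forall>t\<in>U. b z t = b y t + (-1) * b y t \<and> b t z = b t y + (-1) * b t y"
    using assms(1) y(1) unfolding has_combinations_def by blast
  have "\<forall>t\<in>N. d (h y) t = d (h z) t" using h hb[symmetric] y z by auto
  hence "h y = h z" using assms(3) h y(1) z(1) unfolding nondegenerate_def by blast
  hence "b v y = 0" if "v\<in>U" for v using hb[OF that y(1)] hb[OF that z(1)] z(2) that by simp
  thus ?thesis using y(3) by auto
qed

lemma nondegenerate_flip: "nondegenerate (\<lambda>u v. b v u) U \<longleftrightarrow> nondegenerate b U"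
  unfolding nondegenerate_def by (intro ball_cong refl conj_commute)

lemma cut_trivial:
  assumes "has_combinations b U" "form_onto b U d N" "nondegenerate d N" "radical_cut b U U1"
  shows "U1 = U"
  using assms(4) unfolding radical_cut_def
proof
  assume "left_cut b U U1"
  thus ?thesis by (rule left_cut_trivial[OF assms(1-3)])
next
  assume "left_cut (\<lambda>u v. b v u) U U1"
  thus ?thesis
    by (rule left_cut_trivial[OF has_combinations_flip[THEN iffD2, OF assms(1)]
          form_onto_flip[THEN iffD2, OF assms(2)] nondegenerate_flip[THEN iffD2, OF assms(3)]])
qed

text \<open>
  If \<open>b z y \<noteq> 0\<close>, the orthogonal of \<open>y\<close> splits as its intersection with the orthogonal of \<open>z\<close>
  plus the line through \<open>y\<close>. That line lies in both radicals of the orthogonal of \<open>y\<close>, so the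
  projection along it preserves the form.
\<close>
lemma cut_onto_both_cuts:
  assumes "has_combinations b U" "y \<in> U" "\<forall>v\<in>U. b y v = 0" "b z y \<noteq> 0" "z \<in> U"
  shows "form_onto b {v\<in>U. b v y = 0} b {v\<in>U. b v y = 0 \<and> b z v = 0}"
proof -
  define C where "C = {v\<in>U. b v y = 0}"
  define X where "X = {v\<in>U. b v y = 0 \<and> b z v = 0}"
  have XC: "X \<subseteq> C" unfolding X_def C_def by blast
  have "\<exists>w. w \<in> X \<and> (v \<in> X \<longrightarrow> w = v) \<and> (\<forall>t\<in>C. b w t = b v t) \<and> (\<forall>t\<in>C. b t w = b t v)"
    if v: "v \<in> C" for v
  proof (cases "v \<in> X")
    case True
    thus ?thesis by blast
  next
    case False
    \<comment> \<open>The projection \<open>w = v - (b z v / b z y) * y\<close>; the scalar is chosen to make \<open>b z w = 0\<close>.\<close>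
    obtain w where w: "w\<in>U" "\<forall>t\<in>U. b w t = b v t + (- b z v / b z y) * b y t
        \<and> b t w = b t v + (- b z v / b z y) * b t y"
      using assms(1,2) v unfolding has_combinations_def C_def by blast
    have wt: "b w t = b v t" if "t \<in> U" for t using w(2) assms(3) that by simp
    have tw: "b t w = b t v" if "t \<in> C" for t using w(2) that unfolding C_def by simp
    have "b w y = 0" using wt[OF assms(2)] v unfolding C_def by simp
    moreover have "b z w = 0" using w(2)[rule_format, OF assms(5)] assms(4) by simp
    ultimately have "w \<in> X" using w(1) unfolding X_def by simp
    moreover have "\<forall>t\<in>C. b w t = b v t" using wt unfolding C_def by blast
    ultimately show ?thesis using False tw by blast
  qed
  hence "\<forall>v\<in>C. \<exists>w. w \<in> X \<and> (v \<in> X \<longrightarrow> w = v) \<and> (\<forall>t\<in>C. b w t = b v t) \<and> (\<forall>t\<in>C. b t w = b t v)"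
    by (intro ballI)
  from bchoice[OF this] obtain h where h: "\<forall>v\<in>C. h v \<in> X \<and> (v \<in> X \<longrightarrow> h v = v) \<and>
      (\<forall>t\<in>C. b (h v) t = b v t) \<and> (\<forall>t\<in>C. b t (h v) = b t v)"
    by (elim exE)
  have "h ` C = X"
  proof
    show "h ` C \<subseteq> X" using h by blast
    show "X \<subseteq> h ` C"
    proof
      fix x assume "x \<in> X"
      moreover from this have "x \<in> C" "h x = x" using h XC by blast+
      ultimately show "x \<in> h ` C" using imageI[of x C h] by simp
    qed
  qed
  moreover have "b u v = b (h u) (h v)" if u: "u \<in> C" and v: "v \<in> C" for u v
  proof -
    have "h v \<in> C" using h v XC by blast
    hence "b (h u) (h v) = b u (h v)" using h u by blast
    also have "\<dots> = b u v" using h u v by blast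
    finally show ?thesis by simp
  qed
  ultimately have "form_onto b C b X" unfolding form_onto_def by (intro exI[of _ h] conjI ballI)
  thus ?thesis unfolding C_def X_def .
qed

text \<open>
  The two ways in which a pair of cuts can be reconciled: by cutting both once more to the
  same set, or by mapping both onto one form.
\<close>
definition common_reduct :: "('a \<Rightarrow> 'a \<Rightarrow> 'k::field) \<Rightarrow> 'a set \<Rightarrow> 'a set \<Rightarrow> bool" where
  "common_reduct b C D \<longleftrightarrow>
     (\<exists>X. radical_cut b C X \<and> radical_cut b D X) \<or> (\<exists>X. form_onto b C b X \<and> form_onto b D b X)"

lemma left_cuts_commute:
  assumes "left_cut b U C" "left_cut b U D"
  shows "\<exists>X. left_cut b C X \<and> left_cut b D X"
proof -
  obtain y where y: "y \<in> U" "\<forall>v\<in>U. b y v = 0" "C = {v\<in>U. b v y = 0}"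
    using assms(1) unfolding left_cut_def by blast
  obtain z where z: "z \<in> U" "\<forall>v\<in>U. b z v = 0" "D = {v\<in>U. b v z = 0}"
    using assms(2) unfolding left_cut_def by blast
  have "left_cut b C {v\<in>U. b v y = 0 \<and> b v z = 0}"
    unfolding left_cut_def using y z by (intro bexI[of _ z]) auto
  moreover have "left_cut b D {v\<in>U. b v y = 0 \<and> b v z = 0}"
    unfolding left_cut_def using y z by (intro bexI[of _ y]) auto
  ultimately show ?thesis by blast
qed

text \<open>
  Let the cuts be made by \<open>y\<close> on the left and \<open>z\<close> on the right. When \<open>b z y = 0\<close>, each of the two
  vectors survives the cut by the other, and the cuts commute. When \<open>b z y \<noteq> 0\<close>, neither
  survives, but then both cuts already project onto their intersection.
\<close>
lemma left_right_cuts_confluent: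
  assumes "has_combinations b U" "left_cut b U C" "left_cut (\<lambda>u v. b v u) U D"
  shows "common_reduct b C D"
proof -
  obtain y where y: "y \<in> U" "\<forall>v\<in>U. b y v = 0" "C = {v\<in>U. b v y = 0}"
    using assms(2) unfolding left_cut_def by blast
  obtain z where z: "z \<in> U" "\<forall>v\<in>U. b v z = 0" "D = {v\<in>U. b z v = 0}"
    using assms(3) unfolding left_cut_def by blast
  let ?X = "{v\<in>U. b v y = 0 \<and> b z v = 0}"
  show ?thesis
  proof (cases "b z y = 0")
    case True
    have "left_cut (\<lambda>u v. b v u) C ?X"
      unfolding left_cut_def using y z True by (intro bexI[of _ z]) auto
    moreover have "left_cut b D ?X"
      unfolding left_cut_def using y z True by (intro bexI[of _ y]) auto
    ultimately show ?thesis unfolding common_reduct_def radical_cut_def by blast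
  next
    case False
    have "form_onto b C b ?X"
      using cut_onto_both_cuts[OF assms(1) y(1,2) False z(1)] y(3) by simp
    moreover have "form_onto (\<lambda>u v. b v u) D (\<lambda>u v. b v u) ?X"
      using cut_onto_both_cuts[OF has_combinations_flip[THEN iffD2, OF assms(1)] z(1,2) False y(1)] z(3)
      by (simp add: conj_commute)
    hence "form_onto b D b ?X" by (rule form_onto_flip[THEN iffD1])
    ultimately show ?thesis unfolding common_reduct_def by blast
  qed
qed

lemma common_reduct_sym: "common_reduct b C D \<Longrightarrow> common_reduct b D C"
  unfolding common_reduct_def by blast

lemma cuts_confluent:
  assumes "has_combinations b U" "radical_cut b U C" "radical_cut b U D"
  shows "common_reduct b C D"
proof -
  consider "left_cut b U C" "left_cut b U D"
    | "left_cut (\<lambda>u v. b v u) U C" "left_cut (\<lambda>u v. b v u) U D"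
    | "left_cut b U C" "left_cut (\<lambda>u v. b v u) U D"
    | "left_cut (\<lambda>u v. b v u) U C" "left_cut b U D"
    using assms(2,3) unfolding radical_cut_def by blast
  thus ?thesis
  proof cases
    case 1
    thus ?thesis using left_cuts_commute[OF 1] unfolding common_reduct_def radical_cut_def by blast
  next
    case 2
    thus ?thesis using left_cuts_commute[OF 2] unfolding common_reduct_def radical_cut_def by blast
  next
    case 3
    thus ?thesis by (rule left_right_cuts_confluent[OF assms(1)])
  next
    case 4
    from this(2,1) have "common_reduct b D C" by (rule left_right_cuts_confluent[OF assms(1)])
    thus ?thesis by (rule common_reduct_sym)
  qed
qed

text \<open>
  Confluence makes the choice of cuts irrelevant. The induction runs along the chain of cuts
  that leads to the nondegenerate form: each link is compared with the given cut, and the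
  comparison is passed on to the rest of the chain.
\<close>
lemma has_core_cut_iff:
  assumes "has_combinations b U" "nondegenerate d N" "radical_cut b U U1"
  shows "has_core b U d N \<longleftrightarrow> has_core b U1 d N"
proof
  assume "has_core b U d N"
  then obtain U' where "(radical_cut b)\<^sup>*\<^sup>* U U'" "form_onto b U' d N"
    unfolding has_core_def by blast
  thus "has_core b U1 d N" using assms(1,3)
  proof (induction arbitrary: U1 rule: converse_rtranclp_induct)
    case base
    hence "U1 = U'" using cut_trivial assms(2) by blast
    thus ?case using base unfolding has_core_def by blast
  next
    case (step U C)
    from cuts_confluent[OF step.prems(2) step.hyps(1) step.prems(3)]
    consider X where "radical_cut b C X" "radical_cut b U1 X" | X where "form_onto b C b X" "form_onto b U1 b X"
      unfolding common_reduct_def by blast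
    thus ?case
    proof cases
      case (1 X)
      have "has_core b X d N"
        using step.IH step.prems 1(1) has_combinations_cut[OF step.prems(2) step.hyps(1)] by blast
      thus ?thesis using 1(2) has_core_cut by blast
    next
      case (2 X)
      have "has_core b C d N" using step.hyps(2) step.prems(1) unfolding has_core_def by blast
      thus ?thesis using 2 has_core_push has_core_pull assms(2) by blast
    qed
  qed
qed (use assms has_core_cut in blast)

text \<open>
  A nondegenerate form admits only trivial cuts, so that it is its own core. This turns
  equality of cores into an isometry.
\<close>
lemma has_core_nondegenerate:
  assumes "has_combinations b U" "nondegenerate b U" "has_core b U d N"
  shows "form_onto b U d N"
proof -
  obtain U' where U': "(radical_cut b)\<^sup>*\<^sup>* U U'" "form_onto b U' d N"
    using assms(3) unfolding has_core_def by blast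
  from U'(1) have "U' = U"
    by (induction rule: rtranclp_induct) (use cut_trivial form_onto_refl assms in blast)+
  thus ?thesis using U' by simp
qed

section \<open>The form of a matrix\<close>

definition matrix_form :: "rat mat \<Rightarrow> rat vec \<Rightarrow> rat vec \<Rightarrow> rat" where
  "matrix_form A u v = u \<bullet> (A *\<^sub>v v)"

definition matrix_has_core :: "rat mat \<Rightarrow> rat mat \<Rightarrow> bool" where
  "matrix_has_core A N \<longleftrightarrow>
     has_core (matrix_form A) (carrier_vec (dim_row A)) (matrix_form N) (carrier_vec (dim_row N))"

lemma has_combinations_matrix:
  assumes "A \<in> carrier_mat n n"
  shows "has_combinations (matrix_form A) (carrier_vec n)"
  unfolding has_combinations_def matrix_form_def
proof (intro ballI allI)
  fix u v :: "rat vec" and k assume uv: "u \<in> carrier_vec n" "v \<in> carrier_vec n"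
  show "\<exists>w\<in>carrier_vec n. \<forall>t\<in>carrier_vec n.
     w \<bullet> (A *\<^sub>v t) = u \<bullet> (A *\<^sub>v t) + k * (v \<bullet> (A *\<^sub>v t)) \<and>
     t \<bullet> (A *\<^sub>v w) = t \<bullet> (A *\<^sub>v u) + k * (t \<bullet> (A *\<^sub>v v))"
    using assms uv
    by (intro bexI[of _ "u + k \<cdot>\<^sub>v v"])
       (auto simp: add_scalar_prod_distrib[of _ n] scalar_prod_add_distrib[of _ n]
          mult_add_distrib_mat_vec[of _ n n] mult_mat_vec[of _ n n])
qed

lemma mult_unit_vec_col:
  fixes A :: "'a :: semiring_1 mat"
  assumes "A \<in> carrier_mat n m" "j < m"
  shows "A *\<^sub>v unit_vec m j = col A j"
  using assms by (intro eq_vecI) auto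

lemma matrix_form_index:
  assumes "A \<in> carrier_mat n n" "i < n" "j < n"
  shows "matrix_form A (unit_vec n i) (unit_vec n j) = A $$ (i, j)"
  using assms by (simp add: matrix_form_def mult_unit_vec_col[of _ n n])

lemma matrix_form_transpose_mult:
  assumes "A \<in> carrier_mat m m" "P \<in> carrier_mat m n" "u \<in> carrier_vec n" "v \<in> carrier_vec n"
  shows "matrix_form (transpose_mat P * A * P) u v = matrix_form A (P *\<^sub>v u) (P *\<^sub>v v)"
proof -
  have *: "(transpose_mat P * A * P) *\<^sub>v v = transpose_mat P *\<^sub>v (A *\<^sub>v (P *\<^sub>v v))"
    using assms by (simp add: assoc_mult_mat_vec[of _ n m _ n] assoc_mult_mat_vec[of _ m m _ n]
        assoc_mult_mat[of _ n m _ m _ n])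
  have w: "A *\<^sub>v (P *\<^sub>v v) \<in> carrier_vec m" using assms by simp
  hence "u \<bullet> (transpose_mat P *\<^sub>v (A *\<^sub>v (P *\<^sub>v v))) = (transpose_mat P *\<^sub>v (A *\<^sub>v (P *\<^sub>v v))) \<bullet> u"
    using assms(2,3) by (intro comm_scalar_prod[of _ n]) auto
  also have "\<dots> = (A *\<^sub>v (P *\<^sub>v v)) \<bullet> (P *\<^sub>v u)"
    by (rule transpose_vec_mult_scalar[OF assms(2,3) w])
  also have "\<dots> = (P *\<^sub>v u) \<bullet> (A *\<^sub>v (P *\<^sub>v v))"
    using w assms(2,3) by (intro comm_scalar_prod[of _ m]) auto
  finally have "u \<bullet> (transpose_mat P *\<^sub>v (A *\<^sub>v (P *\<^sub>v v))) = (P *\<^sub>v u) \<bullet> (A *\<^sub>v (P *\<^sub>v v))" .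
  thus ?thesis unfolding matrix_form_def using * by simp
qed

lemma invertible_inverse:
  assumes "invertible_mat A" "A \<in> carrier_mat n n"
  obtains B where "B \<in> carrier_mat n n" "A * B = 1\<^sub>m n" "B * A = 1\<^sub>m n"
proof -
  obtain B where B: "inverts_mat A B" "inverts_mat B A"
    using assms(1) unfolding invertible_mat_def by blast
  have AB: "A * B = 1\<^sub>m n" and BA: "B * A = 1\<^sub>m (dim_row B)"
    using B assms(2) unfolding inverts_mat_def by auto
  have "dim_col B = n" using arg_cong[OF AB, of dim_col] by simp
  moreover have "dim_row B = n" using arg_cong[OF BA, of dim_col] assms(2) by simp
  ultimately show ?thesis using that AB BA by auto
qed

lemma invertible_imp_nondegenerate:
  assumes "invertible_mat A" "A \<in> carrier_mat n n"
  shows "nondegenerate (matrix_form A) (carrier_vec n)"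
proof -
  obtain B where B: "B \<in> carrier_mat n n" "A * B = 1\<^sub>m n" "B * A = 1\<^sub>m n"
    using invertible_inverse assms by blast
  show ?thesis unfolding nondegenerate_def
  proof (intro ballI conjI impI)
    fix x y :: "rat vec" assume xy: "x \<in> carrier_vec n" "y \<in> carrier_vec n"
    show "x = y" if e: "\<forall>t\<in>carrier_vec n. matrix_form A x t = matrix_form A y t"
    proof (intro eq_vecI)
      fix i assume "i < dim_vec y"
      hence i: "i < n" using xy by simp
      let ?t = "B *\<^sub>v unit_vec n i"
      have "A *\<^sub>v ?t = unit_vec n i"
        using assms(2) B by (simp flip: assoc_mult_mat_vec[of _ n n _ n])
      moreover have "?t \<in> carrier_vec n" using B by simp
      ultimately have "x \<bullet> unit_vec n i = y \<bullet> unit_vec n i"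
        using e unfolding matrix_form_def by metis
      thus "x $ i = y $ i" using i xy by simp
    qed (use xy in simp)
    show "x = y" if e: "\<forall>t\<in>carrier_vec n. matrix_form A t x = matrix_form A t y"
    proof -
      have "A *\<^sub>v x = A *\<^sub>v y"
      proof (intro eq_vecI)
        fix i assume "i < dim_vec (A *\<^sub>v y)"
        hence i: "i < n" using assms(2) by simp
        have "unit_vec n i \<bullet> (A *\<^sub>v x) = unit_vec n i \<bullet> (A *\<^sub>v y)"
          using e unfolding matrix_form_def by simp
        thus "(A *\<^sub>v x) $ i = (A *\<^sub>v y) $ i" using i xy assms(2)
          by (metis mult_mat_vec_carrier scalar_prod_left_unit)
      qed simp
      hence "B *\<^sub>v (A *\<^sub>v x) = B *\<^sub>v (A *\<^sub>v y)" by simp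
      thus ?thesis using assms(2) B xy by (simp flip: assoc_mult_mat_vec[of _ n n _ n])
    qed
  qed
qed

lemma congruent_form_onto:
  assumes "congruent_mat A B"
  shows "form_onto (matrix_form B) (carrier_vec (dim_row B)) (matrix_form A) (carrier_vec (dim_row A))"
proof -
  obtain n P where P: "A \<in> carrier_mat n n" "B \<in> carrier_mat n n" "P \<in> carrier_mat n n"
     "invertible_mat P" "B = transpose_mat P * A * P"
    using assms unfolding congruent_mat_def by blast
  obtain Q where Q: "Q \<in> carrier_mat n n" "P * Q = 1\<^sub>m n"
    using invertible_inverse P by blast
  have "(*\<^sub>v) P ` carrier_vec n = carrier_vec n"
  proof
    show "carrier_vec n \<subseteq> (*\<^sub>v) P ` carrier_vec n"
    proof
      fix x :: "rat vec" assume x: "x \<in> carrier_vec n"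
      have "x = P *\<^sub>v (Q *\<^sub>v x)" using P Q x by (simp flip: assoc_mult_mat_vec[of _ n n _ n])
      moreover have "Q *\<^sub>v x \<in> carrier_vec n" using Q x by simp
      ultimately show "x \<in> (*\<^sub>v) P ` carrier_vec n" by blast
    qed
  qed (use P in auto)
  moreover have "\<forall>u\<in>carrier_vec n. \<forall>v\<in>carrier_vec n.
      matrix_form B u v = matrix_form A (P *\<^sub>v u) (P *\<^sub>v v)"
    unfolding P(5) using matrix_form_transpose_mult[OF P(1,3)] by blast
  ultimately show ?thesis using P(1,2) unfolding form_onto_def by auto
qed

lemma matrix_form_four_block:
  assumes "A \<in> carrier_mat n n" "B \<in> carrier_mat n m" "C \<in> carrier_mat m n" "D \<in> carrier_mat m m"
    and "a \<in> carrier_vec n" "x \<in> carrier_vec m" "a' \<in> carrier_vec n" "x' \<in> carrier_vec m"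
  shows "matrix_form (four_block_mat A B C D) (a @\<^sub>v x) (a' @\<^sub>v x') =
    a \<bullet> (A *\<^sub>v a') + a \<bullet> (B *\<^sub>v x') + x \<bullet> (C *\<^sub>v a') + x \<bullet> (D *\<^sub>v x')"
proof -
  have "four_block_mat A B C D *\<^sub>v (a' @\<^sub>v x') = (A *\<^sub>v a' + B *\<^sub>v x') @\<^sub>v (C *\<^sub>v a' + D *\<^sub>v x')"
    using four_block_mat_mult_vec[OF assms(1-4,7,8)] .
  thus ?thesis unfolding matrix_form_def using assms
    by (simp add: scalar_prod_append[of _ n _ m] scalar_prod_add_distrib[of _ n] scalar_prod_add_distrib[of _ m])
qed

section \<open>Elementary enlargements\<close>

text \<open>
  Both enlargements have a form of this shape, the row enlargement with its arguments
  exchanged. The last basis vector \<open>y\<close> lies in the left radical, \<open>b v y\<close> is the coordinate of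
  \<open>v\<close> that comes before the last, and on its zero set the form no longer depends on the two new
  coordinates.
\<close>
lemma enlarged_form_cut:
  assumes form: "\<And>a x a' x'. a \<in> carrier_vec n \<Longrightarrow> x \<in> carrier_vec 2 \<Longrightarrow> a' \<in> carrier_vec n \<Longrightarrow>
      x' \<in> carrier_vec 2 \<Longrightarrow>
      e (a @\<^sub>v x) (a' @\<^sub>v x') = b a a' + f a * x' $ 0 + x $ 0 * x' $ 1"
    and zero: "f (0\<^sub>v n) = 0" "\<And>a. a \<in> carrier_vec n \<Longrightarrow> b (0\<^sub>v n) a = 0"
      "\<And>a. a \<in> carrier_vec n \<Longrightarrow> b a (0\<^sub>v n) = 0"
  shows "\<exists>U1. left_cut e (carrier_vec (n + 2)) U1 \<and> form_onto e U1 b (carrier_vec n :: rat vec set)"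
proof -
  let ?V = "carrier_vec (n + 2) :: rat vec set"
  define y :: "rat vec" where "y = 0\<^sub>v n @\<^sub>v unit_vec 2 1"
  define U1 where "U1 = {v\<in>?V. e v y = 0}"
  have y: "y \<in> ?V" unfolding y_def by (intro append_carrier_vec) auto
  have split: "\<exists>a\<in>carrier_vec n. \<exists>x\<in>carrier_vec 2. v = a @\<^sub>v x" if "v \<in> ?V" for v
    using vec_first_last_append[OF that, symmetric]
    by (intro bexI[of _ "vec_first v n"] bexI[of _ "vec_last v 2"]) simp_all
  have yl: "e y v = 0" if "v \<in> ?V" for v
  proof -
    obtain a x where ax: "a \<in> carrier_vec n" "x \<in> carrier_vec 2" "v = a @\<^sub>v x"
      using split[OF \<open>v \<in> ?V\<close>] by (elim bexE)
    show ?thesis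
      using form[of "0\<^sub>v n" "unit_vec 2 1" a x] zero(1) zero(2)[OF ax(1)] ax unfolding y_def by simp
  qed
  have yr: "e (a @\<^sub>v x) y = x $ 0" if "a \<in> carrier_vec n" "x \<in> carrier_vec 2" for a x
    using form[OF that, of "0\<^sub>v n" "unit_vec 2 1"] zero(3)[OF that(1)] unfolding y_def by simp
  have cut: "left_cut e ?V U1" unfolding left_cut_def U1_def
    by (rule bexI[OF _ y]) (simp add: yl)
  have first: "vec_first (a @\<^sub>v x) n = a" if "a \<in> carrier_vec n" for a x :: "rat vec"
    using that by (intro eq_vecI) (auto simp: vec_first_def)
  have "form_onto e U1 b (carrier_vec n)" unfolding form_onto_def
  proof (intro exI[of _ "\<lambda>v. vec_first v n"] conjI ballI)
    show "(\<lambda>v. vec_first v n) ` U1 = carrier_vec n"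
    proof
      show "carrier_vec n \<subseteq> (\<lambda>v. vec_first v n) ` U1"
      proof
        fix a :: "rat vec" assume a: "a \<in> carrier_vec n"
        hence "a @\<^sub>v 0\<^sub>v 2 \<in> ?V" by (intro append_carrier_vec) auto
        hence "a @\<^sub>v 0\<^sub>v 2 \<in> U1" unfolding U1_def using yr[OF a, of "0\<^sub>v 2"] by simp
        thus "a \<in> (\<lambda>v. vec_first v n) ` U1"
          by (rule image_eqI[rotated]) (rule first[OF a, symmetric])
      qed
    qed auto
    fix u v assume u: "u \<in> U1" and v: "v \<in> U1"
    obtain a x where ax: "a \<in> carrier_vec n" "x \<in> carrier_vec 2" "u = a @\<^sub>v x"
      using split[of u] u unfolding U1_def by auto
    obtain a' x' where ax': "a' \<in> carrier_vec n" "x' \<in> carrier_vec 2" "v = a' @\<^sub>v x'"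
      using split[of v] v unfolding U1_def by auto
    have "x $ 0 = 0" "x' $ 0 = 0" using u v yr ax ax' unfolding U1_def by simp_all
    thus "e u v = b (vec_first u n) (vec_first v n)"
      using form[OF ax(1,2) ax'(1,2)] ax(3) ax'(3) first[OF ax(1)] first[OF ax'(1)] by simp
  qed
  thus ?thesis using cut by blast
qed

lemma scalar_prod_two:
  assumes "x \<in> carrier_vec 2"
  shows "u \<bullet> x = u $ 0 * x $ 0 + u $ 1 * (x $ 1 :: 'a :: comm_ring_1)"
proof -
  have "{0..<2} = {0, 1::nat}" by auto
  thus ?thesis using assms unfolding scalar_prod_def carrier_vec_def by simp
qed

lemma mat_of_cols_two_mult:
  assumes "\<alpha> \<in> carrier_vec n" "x \<in> carrier_vec 2"
  shows "mat_of_cols n [\<alpha>, 0\<^sub>v n] *\<^sub>v x = x $ 0 \<cdot>\<^sub>v (\<alpha> :: 'a :: comm_ring_1 vec)"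
proof (intro eq_vecI)
  fix i assume "i < dim_vec (x $ 0 \<cdot>\<^sub>v \<alpha>)"
  hence i: "i < n" using assms(1) by simp
  hence "(mat_of_cols n [\<alpha>, 0\<^sub>v n] *\<^sub>v x) $ i = row (mat_of_cols n [\<alpha>, 0\<^sub>v n]) i \<bullet> x" by simp
  also have "\<dots> = (x $ 0 \<cdot>\<^sub>v \<alpha>) $ i"
    using i assms by (simp add: scalar_prod_two mat_of_cols_index)
  finally show "(mat_of_cols n [\<alpha>, 0\<^sub>v n] *\<^sub>v x) $ i = (x $ 0 \<cdot>\<^sub>v \<alpha>) $ i" .
qed (use assms in simp)

lemma mat_of_rows_two_scalar_prod:
  assumes "\<alpha> \<in> carrier_vec n" "x \<in> carrier_vec 2" "a \<in> carrier_vec n"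
  shows "x \<bullet> (mat_of_rows n [\<alpha>, 0\<^sub>v n] *\<^sub>v a) = x $ 0 * (\<alpha> \<bullet> (a :: 'a :: comm_ring_1 vec))"
proof -
  let ?M = "mat_of_rows n [\<alpha>, 0\<^sub>v n]"
  have "?M *\<^sub>v a \<in> carrier_vec 2" by (rule carrier_vecI) simp
  moreover have "row ?M 0 = \<alpha>" "row ?M 1 = 0\<^sub>v n" using assms(1) by simp_all
  hence "(?M *\<^sub>v a) $ 0 = \<alpha> \<bullet> a" "(?M *\<^sub>v a) $ 1 = 0"
    using assms(3) by (simp_all)
  ultimately show ?thesis by (simp add: scalar_prod_two)
qed

lemma two_block_form:
  assumes "x \<in> carrier_vec 2" "x' \<in> carrier_vec 2"
  shows "x \<bullet> (mat_of_rows_list 2 [[p, q], [r, s]] *\<^sub>v x') =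
    x $ 0 * (p * x' $ 0 + q * x' $ 1) + x $ 1 * (r * x' $ 0 + s * (x' $ 1 :: 'a :: comm_ring_1))"
proof -
  let ?M = "mat_of_rows_list 2 [[p, q], [r, s]]"
  have M: "dim_row ?M = 2" "dim_col ?M = 2" unfolding mat_of_rows_list_def by simp_all
  have "row ?M 0 \<bullet> x' = p * x' $ 0 + q * x' $ 1" "row ?M 1 \<bullet> x' = r * x' $ 0 + s * x' $ 1"
    unfolding scalar_prod_two[OF assms(2)] unfolding mat_of_rows_list_def by simp_all
  hence "(?M *\<^sub>v x') $ 0 = p * x' $ 0 + q * x' $ 1" "(?M *\<^sub>v x') $ 1 = r * x' $ 0 + s * x' $ 1"
    using M by simp_all
  moreover have "?M *\<^sub>v x' \<in> carrier_vec 2" by (rule carrier_vecI) (simp add: M)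
  ultimately show ?thesis by (simp add: scalar_prod_two)
qed

lemma two_block_carrier: "mat_of_rows_list 2 [[p, q], [r, s]] \<in> carrier_mat 2 2"
  by (rule carrier_matI) (simp_all add: mat_of_rows_list_def)

lemma zero_mult_vec:
  fixes v :: "'a :: semiring_0 vec"
  assumes "v \<in> carrier_vec m"
  shows "0\<^sub>m n m *\<^sub>v v = 0\<^sub>v n"
  using assms by (intro eq_vecI) auto

lemma col_enlargement_form:
  assumes "A \<in> carrier_mat n n" "\<alpha> \<in> carrier_vec n"
    "a \<in> carrier_vec n" "x \<in> carrier_vec 2" "a' \<in> carrier_vec n" "x' \<in> carrier_vec 2"
  shows "matrix_form (col_enlargement A \<alpha>) (a @\<^sub>v x) (a' @\<^sub>v x') =
    matrix_form A a a' + (a \<bullet> \<alpha>) * x' $ 0 + x $ 0 * x' $ 1"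
proof -
  have B: "mat_of_cols n [\<alpha>, 0\<^sub>v n] \<in> carrier_mat n 2" by (rule carrier_matI) simp_all
  have C: "0\<^sub>m 2 n *\<^sub>v a' = 0\<^sub>v 2" using assms(5) by (rule zero_mult_vec)
  have n: "dim_row A = n" using assms(1) by simp
  show ?thesis
    unfolding col_enlargement_def Let_def n
      matrix_form_four_block[OF assms(1) B zero_carrier_mat two_block_carrier assms(3-6)]
      mat_of_cols_two_mult[OF assms(2,6)] C two_block_form[OF assms(4,6)]
    unfolding matrix_form_def using assms by simp
qed

lemma row_enlargement_form:
  assumes "A \<in> carrier_mat n n" "\<alpha> \<in> carrier_vec n"
    "a \<in> carrier_vec n" "x \<in> carrier_vec 2" "a' \<in> carrier_vec n" "x' \<in> carrier_vec 2"
  shows "matrix_form (row_enlargement A \<alpha>) (a @\<^sub>v x) (a' @\<^sub>v x') =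
    matrix_form A a a' + (\<alpha> \<bullet> a') * x $ 0 + x' $ 0 * x $ 1"
proof -
  have C: "mat_of_rows n [\<alpha>, 0\<^sub>v n] \<in> carrier_mat 2 n" by (rule carrier_matI) simp_all
  have B: "0\<^sub>m n 2 *\<^sub>v x' = 0\<^sub>v n" using assms(6) by (rule zero_mult_vec)
  have n: "dim_row A = n" using assms(1) by simp
  show ?thesis
    unfolding row_enlargement_def Let_def n
      matrix_form_four_block[OF assms(1) zero_carrier_mat C two_block_carrier assms(3-6)]
      mat_of_rows_two_scalar_prod[OF assms(2,4,5)] B two_block_form[OF assms(4,6)]
    unfolding matrix_form_def using assms by simp
qed

lemma enlargement_carrier:
  assumes "A \<in> carrier_mat n n"
  shows "col_enlargement A \<alpha> \<in> carrier_mat (n + 2) (n + 2)"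
    and "row_enlargement A \<alpha> \<in> carrier_mat (n + 2) (n + 2)"
  unfolding col_enlargement_def row_enlargement_def Let_def
  by (rule four_block_carrier_mat[OF assms two_block_carrier])+

lemma matrix_form_zero:
  assumes "A \<in> carrier_mat n n" "a \<in> carrier_vec n"
  shows "matrix_form A (0\<^sub>v n) a = 0" "matrix_form A a (0\<^sub>v n) = 0"
proof -
  have "A *\<^sub>v 0\<^sub>v n = 0\<^sub>v n" using assms(1) by (intro eq_vecI) auto
  thus "matrix_form A (0\<^sub>v n) a = 0" "matrix_form A a (0\<^sub>v n) = 0"
    using assms unfolding matrix_form_def by simp_all
qed

text \<open>
  An elementary enlargement is undone by one cut followed by forgetting the radical vector.
\<close>
lemma enlargement_cut:
  assumes A: "A \<in> carrier_mat n n" and \<alpha>: "\<alpha> \<in> carrier_vec n"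
    and E: "E = col_enlargement A \<alpha> \<or> E = row_enlargement A \<alpha>"
  shows "\<exists>U1. radical_cut (matrix_form E) (carrier_vec (n + 2)) U1 \<and>
    form_onto (matrix_form E) U1 (matrix_form A) (carrier_vec n)"
  using E
proof
  assume E: "E = col_enlargement A \<alpha>"
  have "\<exists>U1. left_cut (matrix_form E) (carrier_vec (n + 2)) U1 \<and>
    form_onto (matrix_form E) U1 (matrix_form A) (carrier_vec n)"
  proof (rule enlarged_form_cut[of n "matrix_form E" "matrix_form A" "\<lambda>a. a \<bullet> \<alpha>"])
    show "0\<^sub>v n \<bullet> \<alpha> = 0" using \<alpha> by simp
  qed (simp_all only: E col_enlargement_form[OF A \<alpha>] matrix_form_zero[OF A])
  thus ?thesis unfolding radical_cut_def by blast
next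
  assume E: "E = row_enlargement A \<alpha>"
  have "\<exists>U1. left_cut (\<lambda>u v. matrix_form E v u) (carrier_vec (n + 2)) U1 \<and>
    form_onto (\<lambda>u v. matrix_form E v u) U1 (\<lambda>u v. matrix_form A v u) (carrier_vec n)"
  proof (rule enlarged_form_cut[of n "\<lambda>u v. matrix_form E v u" "\<lambda>u v. matrix_form A v u"
        "\<lambda>a. \<alpha> \<bullet> a"])
    show "\<alpha> \<bullet> 0\<^sub>v n = 0" using \<alpha> by simp
  qed (simp_all only: E row_enlargement_form[OF A \<alpha>] matrix_form_zero[OF A])
  then obtain U1 where U1: "left_cut (\<lambda>u v. matrix_form E v u) (carrier_vec (n + 2)) U1"
    "form_onto (\<lambda>u v. matrix_form E v u) U1 (\<lambda>u v. matrix_form A v u) (carrier_vec n)"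
    by (elim exE conjE)
  from U1(2) have "form_onto (matrix_form E) U1 (matrix_form A) (carrier_vec n)"
    by (rule form_onto_flip[THEN iffD1])
  thus ?thesis unfolding radical_cut_def using U1(1) by blast
qed

section \<open>Invariance of the core under S-equivalence\<close>

lemma has_core_onto_iff:
  assumes "form_onto b U c W" "nondegenerate d N"
  shows "has_core b U d N \<longleftrightarrow> has_core c W d N"
  using has_core_pull[OF assms(1)] has_core_push[OF assms(1) _ assms(2)] by (intro iffI)

lemma invertible_nondegenerate_dim_row:
  assumes "invertible_mat N"
  shows "nondegenerate (matrix_form N) (carrier_vec (dim_row N))"
  by (rule invertible_imp_nondegenerate[OF assms]) (use assms in \<open>auto simp: invertible_mat_def\<close>)

lemma matrix_has_core_enlargement:
  assumes "A \<in> carrier_mat n n" "\<alpha> \<in> carrier_vec n"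
    and "E = col_enlargement A \<alpha> \<or> E = row_enlargement A \<alpha>" and "invertible_mat N"
  shows "matrix_has_core A N \<longleftrightarrow> matrix_has_core E N"
proof -
  have E: "E \<in> carrier_mat (n + 2) (n + 2)"
    using assms(3) enlargement_carrier[OF assms(1)] by (elim disjE) simp_all
  have dims: "dim_row A = n" "dim_row E = n + 2" using E assms(1) by simp_all
  obtain U1 where U1: "radical_cut (matrix_form E) (carrier_vec (n + 2)) U1"
    "form_onto (matrix_form E) U1 (matrix_form A) (carrier_vec n)"
    using enlargement_cut[OF assms(1-3)] by (elim exE conjE)
  note N = invertible_nondegenerate_dim_row[OF assms(4)]
  show ?thesis
    unfolding matrix_has_core_def dims has_core_cut_iff[OF has_combinations_matrix[OF E] N U1(1)]
      has_core_onto_iff[OF U1(2) N] ..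
qed

lemma matrix_has_core_congruent:
  assumes "congruent_mat A B" "invertible_mat N"
  shows "matrix_has_core A N \<longleftrightarrow> matrix_has_core B N"
  unfolding matrix_has_core_def
    has_core_onto_iff[OF congruent_form_onto[OF assms(1)] invertible_nondegenerate_dim_row[OF assms(2)]] ..

lemma matrix_has_core_S_equivalent:
  assumes "S_equivalent A B" "invertible_mat N"
  shows "matrix_has_core A N \<longleftrightarrow> matrix_has_core B N"
proof -
  have move: "matrix_has_core A N \<longleftrightarrow> matrix_has_core B N" if "S_move A B" for A B
    using that
  proof cases
    case congruence
    thus ?thesis by (rule matrix_has_core_congruent[OF _ assms(2)])
  next
    case (col_enlarge n \<alpha>)
    show ?thesis
      by (rule matrix_has_core_enlargement[OF col_enlarge(2,3) _ assms(2)]) (simp add: col_enlarge(1))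
  next
    case (row_enlarge n \<alpha>)
    show ?thesis
      by (rule matrix_has_core_enlargement[OF row_enlarge(2,3) _ assms(2)]) (simp add: row_enlarge(1))
  qed
  show ?thesis using assms(1) unfolding S_equivalent_def
    by (induction rule: equivclp_induct) (use move in blast)+
qed

section \<open>From equal cores to congruence\<close>

text \<open>
  A zero block contributes only radical vectors, which the projection to the other block
  forgets.
\<close>
lemma zero_sum_form_onto:
  assumes "N \<in> carrier_mat n n"
  shows "form_onto (matrix_form (diag_block_mat [0\<^sub>m p p, N])) (carrier_vec (p + n))
    (matrix_form N) (carrier_vec n)"
  unfolding form_onto_def
proof (intro exI[of _ "\<lambda>v. vec_last v n"] conjI ballI)
  have "four_block_mat N (0\<^sub>m n 0) (0\<^sub>m 0 n) (0\<^sub>m 0 0) = N"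
    using assms by (intro eq_matI) auto
  hence D: "diag_block_mat [0\<^sub>m p p, N] = four_block_mat (0\<^sub>m p p) (0\<^sub>m p n) (0\<^sub>m n p) N"
    using assms by (simp add: Let_def)
  have last: "vec_last (a @\<^sub>v x) n = x" if "x \<in> carrier_vec n" for a x :: "rat vec"
    using that by (intro eq_vecI) (auto simp: vec_last_def)
  show "(\<lambda>v. vec_last v n) ` carrier_vec (p + n) = (carrier_vec n :: rat vec set)"
  proof
    show "carrier_vec n \<subseteq> (\<lambda>v. vec_last v n) ` (carrier_vec (p + n) :: rat vec set)"
    proof
      fix x :: "rat vec" assume "x \<in> carrier_vec n"
      moreover then have "0\<^sub>v p @\<^sub>v x \<in> carrier_vec (p + n)" by simp
      ultimately show "x \<in> (\<lambda>v. vec_last v n) ` carrier_vec (p + n)" using last by (metis image_eqI)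
    qed
  qed auto
  fix u v :: "rat vec" assume u: "u \<in> carrier_vec (p + n)" and v: "v \<in> carrier_vec (p + n)"
  have "matrix_form (diag_block_mat [0\<^sub>m p p, N]) u v =
    matrix_form (diag_block_mat [0\<^sub>m p p, N])
      (vec_first u p @\<^sub>v vec_last u n) (vec_first v p @\<^sub>v vec_last v n)"
    using vec_first_last_append[OF u] vec_first_last_append[OF v] by simp
  also have "\<dots> = matrix_form N (vec_last u n) (vec_last v n)"
    unfolding D matrix_form_four_block[OF zero_carrier_mat zero_carrier_mat zero_carrier_mat assms
        vec_first_carrier vec_last_carrier vec_first_carrier vec_last_carrier]
      zero_mult_vec[OF vec_first_carrier] zero_mult_vec[OF vec_last_carrier]
    unfolding matrix_form_def by simp
  finally show "matrix_form (diag_block_mat [0\<^sub>m p p, N]) u v =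
    matrix_form N (vec_last u n) (vec_last v n)" .
qed

text \<open>
  Otherwise padding both matrices with zeros to size \<open>n\<close> leaves the product unchanged, but
  makes the first factor singular.
\<close>
lemma right_inverse_dim_le:
  fixes A :: "'a :: field mat"
  assumes A: "A \<in> carrier_mat n m" and B: "B \<in> carrier_mat m n" and AB: "A * B = 1\<^sub>m n"
  shows "n \<le> m"
proof (rule ccontr)
  assume "\<not> n \<le> m"
  hence m: "m < n" by simp
  define A' where "A' = mat n n (\<lambda>(i,j). if j < m then A $$ (i,j) else 0)"
  define B' where "B' = mat n n (\<lambda>(i,j). if i < m then B $$ (i,j) else 0)"
  have carr: "A' \<in> carrier_mat n n" "B' \<in> carrier_mat n n" unfolding A'_def B'_def by auto
  have "A' * B' = A * B"
  proof (intro eq_matI)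
    fix i j assume "i < dim_row (A * B)" "j < dim_col (A * B)"
    hence ij: "i < n" "j < n" using A B by auto
    have "(A' * B') $$ (i,j) = (\<Sum>k = 0..<n. A' $$ (i,k) * B' $$ (k,j))"
      using ij carr by (simp add: scalar_prod_def)
    also have "\<dots> = (\<Sum>k = 0..<m. A' $$ (i,k) * B' $$ (k,j))"
      using ij m by (intro sum.mono_neutral_right) (auto simp: A'_def B'_def)
    also have "\<dots> = (\<Sum>k = 0..<m. A $$ (i,k) * B $$ (k,j))"
      using ij m by (intro sum.cong) (auto simp: A'_def B'_def)
    also have "\<dots> = (A * B) $$ (i,j)" using ij A B by (simp add: scalar_prod_def)
    finally show "(A' * B') $$ (i,j) = (A * B) $$ (i,j)" .
  qed (use carr A B in auto)
  hence "det A' * det B' = 1" using AB det_mult[OF carr] by simp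
  moreover have "det A' = 0"
  proof (subst det_0_iff_vec_prod_zero[OF carr(1)], intro exI conjI)
    show "unit_vec n m \<in> carrier_vec n" "unit_vec n m \<noteq> 0\<^sub>v n" using m by auto
    show "A' *\<^sub>v unit_vec n m = 0\<^sub>v n"
      using m carr(1) by (intro eq_vecI) (auto simp: A'_def mult_unit_vec_col[of _ n n])
  qed
  ultimately show False by simp
qed

text \<open>
  The columns of \<open>P\<close> are the images of the standard basis. The entries of a
  matrix are the products of basis vectors, and the surjection preserves them.
\<close>
lemma form_onto_imp_factorization:
  assumes A: "A \<in> carrier_mat m m" and B: "B \<in> carrier_mat n n"
    and onto: "form_onto (matrix_form B) (carrier_vec n) (matrix_form A) (carrier_vec m)"
  shows "\<exists>P \<in> carrier_mat m n. B = transpose_mat P * A * P"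
proof -
  obtain h where h: "h ` carrier_vec n = carrier_vec m"
    and hb: "\<And>u v. u \<in> carrier_vec n \<Longrightarrow> v \<in> carrier_vec n \<Longrightarrow>
      matrix_form B u v = matrix_form A (h u) (h v)"
    using onto unfolding form_onto_def by blast
  define P where "P = mat_of_cols m (map (\<lambda>j. h (unit_vec n j)) [0..<n])"
  have P: "P \<in> carrier_mat m n" unfolding P_def by (rule carrier_matI) simp_all
  have col: "P *\<^sub>v unit_vec n j = h (unit_vec n j)" if "j < n" for j
  proof -
    have "h (unit_vec n j) \<in> carrier_vec m" unfolding h[symmetric] by (intro imageI) simp
    hence "col P j = h (unit_vec n j)" unfolding P_def using that by simp
    thus ?thesis unfolding mult_unit_vec_col[OF P that] .
  qed
  have PAP: "transpose_mat P * A * P \<in> carrier_mat n n" using P A by simp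
  have "B = transpose_mat P * A * P"
  proof (intro eq_matI)
    fix i j assume "i < dim_row (transpose_mat P * A * P)" "j < dim_col (transpose_mat P * A * P)"
    hence ij: "i < n" "j < n" unfolding carrier_matD[OF PAP] .
    have "B $$ (i, j) = matrix_form B (unit_vec n i) (unit_vec n j)"
      by (rule matrix_form_index[OF B ij, symmetric])
    also have "\<dots> = matrix_form A (h (unit_vec n i)) (h (unit_vec n j))"
      by (rule hb) simp_all
    also have "\<dots> = matrix_form A (P *\<^sub>v unit_vec n i) (P *\<^sub>v unit_vec n j)"
      unfolding col[OF ij(1)] col[OF ij(2)] ..
    also have "\<dots> = matrix_form (transpose_mat P * A * P) (unit_vec n i) (unit_vec n j)"
      by (rule matrix_form_transpose_mult[OF A P, symmetric]) simp_all
    also have "\<dots> = (transpose_mat P * A * P) $$ (i, j)"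
      by (rule matrix_form_index[OF PAP ij])
    finally show "B $$ (i, j) = (transpose_mat P * A * P) $$ (i, j)" .
  qed (simp_all only: carrier_matD[OF PAP] carrier_matD[OF B])
  thus ?thesis by (intro bexI[OF _ P])
qed

lemma form_onto_dim_le:
  assumes A: "A \<in> carrier_mat m m" and B: "B \<in> carrier_mat n n" and inv: "invertible_mat B"
    and onto: "form_onto (matrix_form B) (carrier_vec n) (matrix_form A) (carrier_vec m)"
  shows "n \<le> m"
proof -
  obtain P where P: "P \<in> carrier_mat m n" "B = transpose_mat P * A * P"
    using form_onto_imp_factorization[OF A B onto] by (elim bexE)
  obtain C where C: "C \<in> carrier_mat n n" "B * C = 1\<^sub>m n"
    by (rule invertible_inverse[OF inv B])
  have PA: "transpose_mat P * A \<in> carrier_mat n m" and PC: "P * C \<in> carrier_mat m n"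
    using P(1) C(1) A by simp_all
  have "(transpose_mat P * A) * (P * C) = 1\<^sub>m n"
    unfolding C(2)[symmetric] P(2) by (rule assoc_mult_mat[OF PA P(1) C(1), symmetric])
  thus ?thesis by (rule right_inverse_dim_le[OF PA PC])
qed

text \<open>
  Since \<open>B\<close> is nondegenerate, the surjection can be reversed. Each direction bounds one size
  by the other, so the matrix \<open>P\<close> is square, and it has an inverse because \<open>B\<close> has.
\<close>
lemma form_onto_imp_congruent:
  assumes invA: "invertible_mat A" and invB: "invertible_mat B"
    and onto: "form_onto (matrix_form B) (carrier_vec (dim_row B))
      (matrix_form A) (carrier_vec (dim_row A))"
  shows "congruent_mat A B"
proof -
  define m n where "m = dim_row A" and "n = dim_row B"
  have A: "A \<in> carrier_mat m m" and B: "B \<in> carrier_mat n n"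
    using invA invB unfolding invertible_mat_def m_def n_def by auto
  note onto = onto[folded m_def n_def]
  have "form_onto (matrix_form A) (carrier_vec m) (matrix_form B) (carrier_vec n)"
    by (rule form_onto_factor[OF onto form_onto_refl invertible_imp_nondegenerate[OF invB B]])
  hence mn: "m = n"
    using form_onto_dim_le[OF A B invB onto] form_onto_dim_le[OF B A invA] by simp
  obtain P where "P \<in> carrier_mat m n" and BP: "B = transpose_mat P * A * P"
    using form_onto_imp_factorization[OF A B onto] by (elim bexE)
  hence P: "P \<in> carrier_mat n n" using mn by simp
  obtain C where C: "C \<in> carrier_mat n n" "C * B = 1\<^sub>m n"
    by (rule invertible_inverse[OF invB B])
  have PA: "transpose_mat P * A \<in> carrier_mat n n" using P A mn by simp
  let ?Q = "C * (transpose_mat P * A)"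
  have Q: "?Q \<in> carrier_mat n n" using C(1) PA by simp
  have QP: "?Q * P = 1\<^sub>m n"
    unfolding C(2)[symmetric] BP by (rule assoc_mult_mat[OF C(1) PA P])
  have PQ: "P * ?Q = 1\<^sub>m n" by (rule mat_mult_left_right_inverse[OF Q P QP])
  have "inverts_mat P ?Q" "inverts_mat ?Q P"
    unfolding inverts_mat_def using QP PQ P Q by auto
  hence "invertible_mat P" unfolding invertible_mat_def using P by auto
  thus ?thesis unfolding congruent_mat_def using A B P BP mn by blast
qed

theorem proposition4p4:
  fixes S S' S'' S'\<^sub>0 S'\<^sub>i\<^sub>n S''\<^sub>0 S''\<^sub>i\<^sub>n :: "rat mat"
    and p q :: nat
  assumes "square_mat S" and "square_mat S'" and "square_mat S''"
    and "S_equivalent S S'" and "S_equivalent S S''"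
    and "S' = diag_block_mat [S'\<^sub>0, S'\<^sub>i\<^sub>n]" and "S'' = diag_block_mat [S''\<^sub>0, S''\<^sub>i\<^sub>n]"
    and "S'\<^sub>0 = 0\<^sub>m p p" and "S''\<^sub>0 = 0\<^sub>m q q"
    and "invertible_mat S'\<^sub>i\<^sub>n" and "invertible_mat S''\<^sub>i\<^sub>n"
  shows "congruent_mat S'\<^sub>i\<^sub>n S''\<^sub>i\<^sub>n"
proof -
  let ?A = "S'\<^sub>i\<^sub>n" and ?B = "S''\<^sub>i\<^sub>n"
  define m n where "m = dim_row ?A" and "n = dim_row ?B"
  have A: "?A \<in> carrier_mat m m" and B: "?B \<in> carrier_mat n n"
    using assms(10,11) unfolding invertible_mat_def m_def n_def by auto
  have dims: "dim_row S' = p + m" "dim_row S'' = q + n"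
    using A B unfolding assms(6-9) by (simp_all add: Let_def)
  have onto': "form_onto (matrix_form S') (carrier_vec (p + m)) (matrix_form ?A) (carrier_vec m)"
    unfolding assms(6,8) by (rule zero_sum_form_onto[OF A])
  have onto'': "form_onto (matrix_form S'') (carrier_vec (q + n)) (matrix_form ?B) (carrier_vec n)"
    unfolding assms(7,9) by (rule zero_sum_form_onto[OF B])
  have "matrix_has_core S' ?A"
    unfolding matrix_has_core_def has_core_def dims using onto' A by auto
  hence "matrix_has_core S'' ?A"
    using matrix_has_core_S_equivalent assms(4,5,10) by blast
  hence "has_core (matrix_form S'') (carrier_vec (q + n)) (matrix_form ?A) (carrier_vec m)"
    unfolding matrix_has_core_def dims m_def .
  hence "has_core (matrix_form ?B) (carrier_vec n) (matrix_form ?A) (carrier_vec m)"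
    by (rule has_core_push[OF onto'' _ invertible_imp_nondegenerate[OF assms(10) A]])
  hence "form_onto (matrix_form ?B) (carrier_vec n) (matrix_form ?A) (carrier_vec m)"
    by (rule has_core_nondegenerate[OF has_combinations_matrix[OF B]
          invertible_imp_nondegenerate[OF assms(11) B]])
  thus ?thesis unfolding m_def n_def by (rule form_onto_imp_congruent[OF assms(10,11)])
qed

end
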